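(* Let $X=\{x_1,\dots,x_n\}$ be a finite set with $n\ge 1$ elements in a fixed enumeration, and let $(X,\bullet)$ be a groupoid with the orientation property. Then $(X,\bullet)$ has a $JO$-factorization, i.e. $(X,\bullet)=J(X,\bullet)\diamond O(X,\bullet)$.
   Context: A groupoid $(X,\bullet)$ is a non-empty set $X$ with an arbitrary binary operation $\bullet:X\times X\to X$. It has the orientation property if $x\bullet y\in\{x,y\}$ for all $x,y\in X$. For groupoids $(X,\ast)$, $(X,\circ)$ on the same set $X$, the product $(X,\ast)\diamond(X,\circ)$ is the groupoid $(X,\cdot)$ with $x\cdot y=(x\ast y)\circ(y\ast x)$ for all $x,y\in X$. Let $X=\{x_1,\dots,x_n\}$ be finite with a fixed enumeration. The orient-factor $O(X,\bullet)=(X,\ast)$ is defined by $x_i\ast x_j=x_j$ if $i+j=n+1$, and $x_i\ast x_j=x_i$ otherwise. The skew-factor $J(X,\bullet)=(X,\circ)$ is defined by $x_i\circ x_j=x_j\bullet x_i$ if $i+j=n+1$, and $x_i\circ x_j=x_i\bullet x_j$ otherwise. *)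

theory Defs
  imports "HOL-Library.FuncSet"
begin

record 'a groupoid =
  carrier :: "'a set"
  opn :: "'a \<Rightarrow> 'a \<Rightarrow> 'a"

(* Operations are extensional (undefined outside the carrier), so that equality of
   records is exactly equality of groupoids (X, f) with f : X \<times> X \<rightarrow> X. *)
definition is_groupoid :: "'a groupoid \<Rightarrow> bool" where
  "is_groupoid G \<longleftrightarrow>
     carrier G \<noteq> {} \<and> opn G \<in> carrier G \<rightarrow>\<^sub>E (carrier G \<rightarrow>\<^sub>E carrier G)"

definition orientation_property :: "'a groupoid \<Rightarrow> bool" where
  "orientation_property G \<longleftrightarrow> (\<forall>a\<in>carrier G. \<forall>b\<in>carrier G. opn G a b \<in> {a, b})"

(* Meaningful only for groupoids with the same carrier. *)
definition groupoid_prod :: "'a groupoid \<Rightarrow> 'a groupoid \<Rightarrow> 'a groupoid"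
  (infixl "\<diamond>" 70) where
  "G \<diamond> H = \<lparr> carrier = carrier G,
     opn = (\<lambda>a\<in>carrier G. \<lambda>b\<in>carrier G. opn H (opn G a b) (opn G b a)) \<rparr>"

definition enumerates :: "nat \<Rightarrow> (nat \<Rightarrow> 'a) \<Rightarrow> 'a set \<Rightarrow> bool" where
  "enumerates n x X \<longleftrightarrow> bij_betw x {1..n} X"

definition pos :: "nat \<Rightarrow> (nat \<Rightarrow> 'a) \<Rightarrow> 'a \<Rightarrow> nat" where
  "pos n x a = the_inv_into {1..n} x a"

definition orient_factor :: "nat \<Rightarrow> (nat \<Rightarrow> 'a) \<Rightarrow> 'a groupoid \<Rightarrow> 'a groupoid" where
  "orient_factor n x G = \<lparr> carrier = carrier G,
     opn = (\<lambda>a\<in>carrier G. \<lambda>b\<in>carrier G.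
       if pos n x a + pos n x b = n + 1 then b else a) \<rparr>"

definition skew_factor :: "nat \<Rightarrow> (nat \<Rightarrow> 'a) \<Rightarrow> 'a groupoid \<Rightarrow> 'a groupoid" where
  "skew_factor n x G = \<lparr> carrier = carrier G,
     opn = (\<lambda>a\<in>carrier G. \<lambda>b\<in>carrier G.
       if pos n x a + pos n x b = n + 1 then opn G b a else opn G a b) \<rparr>"

lemma pos_enum:
  assumes "enumerates n x X" and "i \<in> {1..n}"
  shows "pos n x (x i) = i"
  using assms by (simp add: enumerates_def pos_def bij_betw_def the_inv_into_f_f)

lemma orient_factor_enum:
  assumes "enumerates n x (carrier G)" and "i \<in> {1..n}" and "j \<in> {1..n}"
  shows "opn (orient_factor n x G) (x i) (x j) = (if i + j = n + 1 then x j else x i)"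
proof -
  have "x i \<in> carrier G" "x j \<in> carrier G"
    using assms by (auto simp: enumerates_def bij_betw_def)
  then show ?thesis
    using assms by (simp add: orient_factor_def pos_enum)
qed

lemma skew_factor_enum:
  assumes "enumerates n x (carrier G)" and "i \<in> {1..n}" and "j \<in> {1..n}"
  shows "opn (skew_factor n x G) (x i) (x j) =
    (if i + j = n + 1 then opn G (x j) (x i) else opn G (x i) (x j))"
proof -
  have "x i \<in> carrier G" "x j \<in> carrier G"
    using assms by (auto simp: enumerates_def bij_betw_def)
  then show ?thesis
    using assms by (simp add: skew_factor_def pos_enum)
qed

lemma is_groupoid_orient_factor: "is_groupoid G \<Longrightarrow> is_groupoid (orient_factor n x G)"
  by (auto simp: is_groupoid_def orient_factor_def)

lemma is_groupoid_skew_factor: "is_groupoid G \<Longrightarrow> is_groupoid (skew_factor n x G)"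
  unfolding is_groupoid_def skew_factor_def by (auto, (meson PiE_mem)+)

end

theory Submission imports Defs begin

text \<open>By the orientation property, the pair (a \<bullet> b, b \<bullet> a) is constant or equals (a, b) or
  (b, a). The orient-factor is idempotent, which settles constant pairs. On the other pairs it
  is the first projection off the antidiagonal \<open>i + j = n + 1\<close> and the second projection on it,
  where the skew-factor has swapped the two entries; so the result is \<open>a \<bullet> b\<close> either way.\<close>

lemma opn_skew_orient:
  assumes "orientation_property G" and "a \<in> carrier G" and "b \<in> carrier G"
  shows "opn (skew_factor n x G \<diamond> orient_factor n x G) a b = opn G a b"
proof -
  have "opn G a b = a \<or> opn G a b = b" "opn G b a = a \<or> opn G b a = b"
    using assms by (auto simp: orientation_property_def)
  then show ?thesis
    using assms(2,3)
    \<comment> \<open>\<open>add.commute\<close> identifies the antidiagonal tests for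
      \<open>(a, b)\<close> and \<open>(b, a)\<close>, so the skew-factor swaps both products or
      neither.\<close>
    by (auto simp: groupoid_prod_def skew_factor_def orient_factor_def add.commute)
qed

text \<open>Operations are \<open>undefined\<close> off the carrier, so agreement on the carrier
  already forces equality of the records.\<close>

lemma groupoid_eqI:
  fixes G H :: "'a groupoid"
  assumes "is_groupoid G" and "is_groupoid H" and carr: "carrier G = carrier H"
    and opn: "\<And>a b. a \<in> carrier G \<Longrightarrow> b \<in> carrier G \<Longrightarrow> opn G a b = opn H a b"
  shows "G = H"
proof -
  have G: "opn G \<in> carrier G \<rightarrow>\<^sub>E (carrier G \<rightarrow>\<^sub>E carrier G)"
    and H: "opn H \<in> carrier G \<rightarrow>\<^sub>E (carrier G \<rightarrow>\<^sub>E carrier G)"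
    using assms(1,2) carr by (auto simp: is_groupoid_def)
  have "opn G = opn H"
  proof (rule PiE_ext[OF G H])
    fix a assume a: "a \<in> carrier G"
    show "opn G a = opn H a"
      \<comment> \<open>The operation is curried, so extensionality is needed again for the rows
        \<open>opn G a\<close> and \<open>opn H a\<close>.\<close>
      by (rule PiE_ext[OF PiE_mem[OF G a] PiE_mem[OF H a]]) (rule opn[OF a])
  qed
  with carr show ?thesis by simp
qed

lemma is_groupoid_prod:
  assumes "is_groupoid G" and "is_groupoid H" and "carrier G = carrier H"
  shows "is_groupoid (G \<diamond> H)"
  using assms unfolding is_groupoid_def groupoid_prod_def
  by (auto, (meson PiE_mem)+)

theorem theorem4p2p3:
  fixes G :: "'a groupoid" and x :: "nat \<Rightarrow> 'a" and n :: nat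
  assumes "n \<ge> 1"
    and "enumerates n x (carrier G)"
    and "is_groupoid G"
    and "orientation_property G"
  shows "G = skew_factor n x G \<diamond> orient_factor n x G"
proof (rule groupoid_eqI)
  show "is_groupoid (skew_factor n x G \<diamond> orient_factor n x G)"
    using assms(3)
    by (intro is_groupoid_prod is_groupoid_skew_factor is_groupoid_orient_factor)
      (simp_all add: skew_factor_def orient_factor_def)
  show "carrier G = carrier (skew_factor n x G \<diamond> orient_factor n x G)"
    by (simp add: groupoid_prod_def skew_factor_def)
qed (simp_all add: assms(3,4) opn_skew_orient)

end
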